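(* Let $T=(V,E)$ be a tree with $T=\underline{\mathrm{Cay}}(M,C)$ for some finite monoid $M$ with neutral element $e$ and some $C\subseteq M$ with $e\notin C$ and $M=\langle C\rangle$. Then for each $x\in V\setminus\{e\}$ there is a $y\in V$ with $d(e,x)=d(e,y)+1$ and $b_e(x)\leq b_e(y)$. Moreover, if $\mathrm{Aut}(T)\cap\{\varphi_x\mid x\in M\}=\{\mathrm{id}\}$, then for each vertex $x\in V$ and each $c\in C$ there is a vertex $y_c\in\mathcal B_e(c)$ with $d(e,y_c)\leq d(e,x)+1$ and $b_e(y_c)\leq b_e(x)+\varepsilon$, where $\varepsilon=0$ if $x\in C\cup\{e\}$ and $\varepsilon=1$ otherwise.
   Context: For a monoid $M$ and $C\subseteq M$, $\underline{\mathrm{Cay}}(M,C)$ is the simple undirected graph with vertex set $M$ in which distinct $x,y$ are adjacent if and only if $y=xc$ or $x=yc$ for some $c\in C$. $M=\langle C\rangle$ means that $C$ generates $M$ as a monoid. $d$ is the graph distance in $T$. For a vertex $x$, $b_e(x)=|\{y\in V\mid \{x,y\}\in E,\ d(e,y)=d(e,x)+1\}|$. For a neighbor $c$ of $e$, the branch of $c$ with respect to $e$ is $\mathcal B_e(c)=\{x\in V\mid d(c,x)<d(e,x)\}$. For $x\in M$, $\varphi_x:M\to M$, $\varphi_x(y)=xy$, is left-multiplication by $x$. $\mathrm{Aut}(T)$ is the group of graph automorphisms of $T$. *)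

theory Defs
  imports "HOL-Algebra.Bij" "Graph_Theory.Graph_Theory"
begin

text \<open>
  A simple undirected graph is a \<open>pair_pre_digraph\<close> satisfying \<open>pair_bidirected_digraph\<close>:
  a symmetric, loop-free set of ordered pairs, where the edge \<open>{x, y}\<close> is represented by the
  two arcs \<open>(x, y)\<close> and \<open>(y, x)\<close>. No finiteness is required of it.
\<close>

definition cayley_graph :: "('a, 'b) monoid_scheme \<Rightarrow> 'a set \<Rightarrow> 'a pair_pre_digraph" where
  "cayley_graph M C =
    \<lparr> pverts = carrier M,
      parcs = {(x, y). x \<in> carrier M \<and> y \<in> carrier M \<and> x \<noteq> y \<and>
                 (\<exists>c\<in>C. y = x \<otimes>\<^bsub>M\<^esub> c \<or> x = y \<otimes>\<^bsub>M\<^esub> c)} \<rparr>"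

lemma pair_bidirected_digraph_cayley_graph: "pair_bidirected_digraph (cayley_graph M C)"
  by unfold_locales (auto simp: cayley_graph_def symmetric_def intro!: symI)

definition generates_monoid :: "('a, 'b) monoid_scheme \<Rightarrow> 'a set \<Rightarrow> bool" where
  "generates_monoid M C \<longleftrightarrow> C \<subseteq> carrier M \<and> (\<lambda>H. submonoid H M) hull C = carrier M"

text \<open>
  The library's \<open>tree\<close> and \<open>forest\<close> do not fit undirected graphs: there the two arcs of a single
  edge already form a cycle of length 2. Cycles of an undirected graph have length at least 3.
\<close>

definition undirected_tree :: "'a pair_pre_digraph \<Rightarrow> bool" where
  "undirected_tree G \<longleftrightarrow>
     pair_bidirected_digraph G \<and> connected (with_proj G) \<and>
     \<not> (\<exists>p. pre_digraph.cycle (with_proj G) p \<and> 3 \<le> length p)"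

text \<open>Only meaningful if \<open>v\<close> is reachable from \<open>u\<close>, which always holds in a connected graph.\<close>

definition graph_dist :: "'a pair_pre_digraph \<Rightarrow> 'a \<Rightarrow> 'a \<Rightarrow> nat" where
  "graph_dist G u v = (LEAST n. \<exists>p. pre_digraph.awalk (with_proj G) u p v \<and> length p = n)"

lemma graph_dist_eq_shortest_path:
  assumes "pair_wf_digraph G" and "u \<rightarrow>\<^sup>*\<^bsub>with_proj G\<^esub> v"
  shows "ereal (real (graph_dist G u v)) = wf_digraph.\<mu> (with_proj G) (\<lambda>_. 1) u v"
proof -
  interpret pair_wf_digraph G by fact
  let ?P = "\<lambda>n. \<exists>p. awalk u p v \<and> length p = n"
  have cost: "awalk_cost (\<lambda>_. 1) p = real (length p)" for p :: "('a \<times> 'a) list"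
    by (induction p) auto
  obtain q where "awalk u q v" using assms(2) reachable_awalk by auto
  then have "?P (graph_dist G u v)"
    unfolding graph_dist_def by (intro LeastI[of ?P "length q"]) auto
  then obtain p where p: "awalk u p v" "length p = graph_dist G u v" by blast
  have le: "graph_dist G u v \<le> length r" if "awalk u r v" for r
    unfolding graph_dist_def using that by (intro Least_le) auto
  show ?thesis
  proof (rule antisym)
    show "ereal (real (graph_dist G u v)) \<le> \<mu> (\<lambda>_. 1) u v"
      unfolding \<mu>_def by (intro INF_greatest) (auto simp: cost le)
    show "\<mu> (\<lambda>_. 1) u v \<le> ereal (real (graph_dist G u v))"
      using min_cost_le_walk_cost[OF p(1), of "\<lambda>_. 1"] p(2) by (simp add: cost)
  qed
qed

definition outer_degree :: "'a pair_pre_digraph \<Rightarrow> 'a \<Rightarrow> 'a \<Rightarrow> nat" where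
  "outer_degree G r x =
     card {y \<in> pverts G. (x, y) \<in> parcs G \<and> graph_dist G r y = graph_dist G r x + 1}"

definition branch :: "'a pair_pre_digraph \<Rightarrow> 'a \<Rightarrow> 'a \<Rightarrow> 'a set" where
  "branch G r c = {x \<in> pverts G. graph_dist G c x < graph_dist G r x}"

text \<open>
  Self-maps of a vertex set or carrier are \<open>extensional\<close> functions, so that equality of
  functions is equality as maps on that set; the identity map of \<open>S\<close> is \<open>\<lambda>x\<in>S. x\<close>.
\<close>

definition graph_Aut :: "'a pair_pre_digraph \<Rightarrow> ('a \<Rightarrow> 'a) set" where
  "graph_Aut G =
     {f \<in> Bij (pverts G). \<forall>x\<in>pverts G. \<forall>y\<in>pverts G. (f x, f y) \<in> parcs G \<longleftrightarrow> (x, y) \<in> parcs G}"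

definition left_mult :: "('a, 'b) monoid_scheme \<Rightarrow> 'a \<Rightarrow> 'a \<Rightarrow> 'a" where
  "left_mult M x = (\<lambda>y\<in>carrier M. x \<otimes>\<^bsub>M\<^esub> y)"

end

theory Submission
  imports Defs
begin

text \<open>
  Call the neighbours of \<open>x\<close> that are farther from \<open>e\<close> its children. Every child of \<open>x\<close> has the
  form \<open>x c'\<close> with \<open>c' \<in> C\<close>, so the distance from \<open>e\<close> is the word length with respect to \<open>C\<close>.
  For the first claim write \<open>x = c y\<close>, where \<open>c\<close> is the first letter of a shortest word for \<open>x\<close>;
  left multiplication by \<open>c\<close> maps the children of \<open>y\<close> onto a set containing those of \<open>x\<close>. For the
  second take \<open>y\<^sub>c = c x\<close>: every child of \<open>c x\<close> is \<open>c\<close> times a child of \<open>x\<close> or \<open>c\<close> times the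
  parent of \<open>x\<close>. If \<open>c\<close> had a right inverse, then \<open>\<phi>\<^sub>c\<close> would be a nontrivial automorphism by
  finiteness; so the walk from \<open>c\<close> to \<open>c x\<close> obtained by multiplying a walk from \<open>e\<close> to \<open>x\<close> by \<open>c\<close>
  avoids \<open>e\<close> and stays in the branch of \<open>c\<close>.
\<close>

section \<open>Walks and distances in directed graphs\<close>

context pair_wf_digraph
begin

text \<open>Deleting an edge is expressed below by reachability in a smaller arc set
  \<open>R\<close>; this turns such reachability into a walk of \<open>G\<close> whose arcs are
  known to lie in \<open>R\<close>.\<close>

lemma reachable_imp_awalk_in_arcs:
  assumes "(u, v) \<in> R\<^sup>*" and "R \<subseteq> parcs G" and "u \<in> pverts G"
  shows "\<exists>p. awalk u p v \<and> set p \<subseteq> R"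
  using assms(1)
proof induction
  case base
  show ?case using assms(3) by (intro exI[of _ "[]"]) (auto simp: awalk_Nil_iff)
next
  case (step v w)
  then obtain p where p: "awalk u p v" "set p \<subseteq> R" by blast
  have "(v, w) \<in> parcs G" using step assms(2) by blast
  moreover have "w \<in> pverts G" using calculation by (simp add: in_arcsD2)
  ultimately have "awalk u (p @ [(v, w)]) w"
    using p(1) by (auto simp: awalk_simps)
  then show ?case using p(2) step by (intro exI[of _ "p @ [(v, w)]"]) auto
qed

lemma graph_dist_le: "awalk u p v \<Longrightarrow> graph_dist G u v \<le> length p"
  unfolding graph_dist_def by (intro Least_le) auto

end

section \<open>Distances, parents and branches in undirected trees\<close>

locale undirected_tree_graph = pair_bidirected_digraph G for G :: "'a pair_pre_digraph" +
  assumes connected: "connected (with_proj G)"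
    and no_cycle: "\<not> (\<exists>p. cycle p \<and> 3 \<le> length p)"
begin

lemma geodesic:
  assumes "u \<in> pverts G" and "v \<in> pverts G"
  obtains p where "awalk u p v" and "length p = graph_dist G u v"
proof -
  have "u \<rightarrow>\<^sup>*\<^bsub>with_proj (mk_symmetric G)\<^esub> v"
    using connected assms by (auto simp: connected_def strongly_connected_def)
  then have "u \<rightarrow>\<^sup>*\<^bsub>with_proj G\<^esub> v"
    using reachable_mk_symmetric_eq[OF sym_arcs] by blast
  then have "\<exists>n p. awalk u p v \<and> length p = n" using reachable_awalk by auto
  then have "\<exists>p. awalk u p v \<and> length p = graph_dist G u v"
    unfolding graph_dist_def by (rule LeastI_ex)
  then show thesis using that by blast
qed

lemma graph_dist_self [simp]: "u \<in> pverts G \<Longrightarrow> graph_dist G u u = 0"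
  using graph_dist_le[of u "[]" u] by (simp add: awalk_Nil_iff)

lemma graph_dist_eq_0_iff:
  assumes "u \<in> pverts G" and "v \<in> pverts G"
  shows "graph_dist G u v = 0 \<longleftrightarrow> u = v"
proof
  assume "graph_dist G u v = 0"
  then obtain p where "awalk u p v" "length p = 0" using geodesic[OF assms] by metis
  then show "u = v" by (simp add: awalk_Nil_iff)
qed (use assms in auto)

lemma graph_dist_adj_le:
  assumes "u \<in> pverts G" and "(a, b) \<in> parcs G"
  shows "graph_dist G u b \<le> graph_dist G u a + 1"
proof -
  have "a \<in> pverts G" "b \<in> pverts G" using assms(2) by (auto dest: wellformed')
  then obtain p where p: "awalk u p a" "length p = graph_dist G u a"
    using geodesic assms(1) by metis
  have "awalk u (p @ [(a, b)]) b"
    using p(1) assms(2) \<open>b \<in> pverts G\<close> by (auto simp: awalk_simps)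
  from graph_dist_le[OF this] show ?thesis using p(2) by simp
qed

lemma parent_exists:
  assumes "u \<in> pverts G" and "v \<in> pverts G" and "u \<noteq> v"
  obtains a where "(a, v) \<in> parcs G" and "graph_dist G u v = graph_dist G u a + 1"
proof -
  obtain p where p: "awalk u p v" "length p = graph_dist G u v"
    using geodesic assms by metis
  have "p \<noteq> []" using p(1) assms(3) by (auto simp: awalk_Nil_iff)
  then obtain q a b where q: "p = q @ [(a, b)]" by (metis rev_exhaust surj_pair)
  then have "awalk u q a" "(a, v) \<in> parcs G" using p(1) by (auto simp: awalk_simps)
  then show thesis
    using that[of a] graph_dist_le[of u q a] graph_dist_adj_le[OF assms(1), of a v] p(2) q
    by fastforce
qed

text \<open>A walk from \<open>y\<close> to \<open>z\<close> without this edge could be shortened to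
  a path of length at least 2, which the arc \<open>(z, y)\<close> would close to a forbidden
  cycle.\<close>

lemma bridge:
  assumes "(y, z) \<in> parcs G"
  shows "(y, z) \<notin> (parcs G - {(y, z), (z, y)})\<^sup>*"
proof
  let ?R = "parcs G - {(y, z), (z, y)}"
  assume "(y, z) \<in> ?R\<^sup>*"
  then obtain p where p: "awalk y p z" "set p \<subseteq> ?R"
    using reachable_imp_awalk_in_arcs[of y z ?R] assms by (auto dest: wellformed')
  define q where "q = awalk_to_apath p"
  have q: "apath y q z" "set q \<subseteq> ?R"
    using apath_awalk_to_apath[OF p(1)] awalk_to_apath_subset[OF p(1)] p(2)
    by (auto simp: q_def)
  have "y \<noteq> z" using assms no_loops' by blast
  then obtain e q' where e: "q = e # q'" using q(1) by (cases q) (auto simp: apath_simps)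
  with q have "q' \<noteq> []" by (auto simp: apath_simps)
  then have "2 \<le> length q" using e by (cases q') auto
  have zy: "(z, y) \<in> parcs G" using assms by (rule arcs_symmetric)
  have "awalk z ((z, y) # q) z"
    using q(1) zy by (auto simp: awalk_simps apath_def dest: wellformed')
  moreover have "distinct (tl (awalk_verts z ((z, y) # q)))"
    using q(1) by (simp add: apath_def)
  ultimately have "cycle ((z, y) # q)" unfolding cycle_def by blast
  with \<open>2 \<le> length q\<close> no_cycle show False by force
qed

text \<open>Following parents from \<open>w\<close> towards \<open>r\<close> strictly decreases the
  distance from \<open>r\<close>, so this geodesic never visits \<open>z\<close> and uses no arc at
  \<open>z\<close>.\<close>

lemma reachable_without_far_arc:
  assumes "r \<in> pverts G" and "w \<in> pverts G"
    and "graph_dist G r w < graph_dist G r z \<or> (graph_dist G r w = graph_dist G r z \<and> w \<noteq> z)"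
  shows "(r, w) \<in> (parcs G - {(y, z), (z, y)})\<^sup>*"
  using assms(2,3)
proof (induction "graph_dist G r w" arbitrary: w rule: less_induct)
  case less
  show ?case
  proof (cases "w = r")
    case False
    then obtain a where a: "(a, w) \<in> parcs G" "graph_dist G r w = graph_dist G r a + 1"
      using parent_exists[OF assms(1) less(2)] by metis
    then have "(r, a) \<in> (parcs G - {(y, z), (z, y)})\<^sup>*"
      using less by (auto dest: wellformed')
    moreover have "(a, w) \<in> parcs G - {(y, z), (z, y)}" using a less(3) by auto
    ultimately show ?thesis by (rule rtrancl_into_rtrancl)
  qed simp
qed

lemma sym_reachable:
  assumes "(u, v) \<in> (parcs G - {(y, z), (z, y)})\<^sup>*"
  shows "(v, u) \<in> (parcs G - {(y, z), (z, y)})\<^sup>*"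
proof -
  have "sym (parcs G - {(y, z), (z, y)})" by (auto intro!: symI arcs_symmetric)
  then show ?thesis using assms by (metis sym_rtrancl symD)
qed

text \<open>Otherwise \<open>v\<close> would reach \<open>x\<close> through \<open>r\<close> and
  \<open>w\<close> without the edge between \<open>v\<close> and \<open>x\<close>, which is a
  bridge. The bound \<le> also covers neighbours at equal distance, as \<open>adj_cases\<close>
  requires.\<close>

lemma parent_unique:
  assumes r: "r \<in> pverts G"
    and v: "(v, x) \<in> parcs G" "graph_dist G r v \<le> graph_dist G r x"
    and w: "(w, x) \<in> parcs G" "graph_dist G r w \<le> graph_dist G r x"
  shows "v = w"
proof (rule ccontr)
  assume "v \<noteq> w"
  let ?R = "parcs G - {(v, x), (x, v)}"
  have "v \<noteq> x" "w \<noteq> x" using v w no_loops' by blast+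
  then have "(r, v) \<in> ?R\<^sup>*" "(r, w) \<in> ?R\<^sup>*"
    using v w by (auto intro!: reachable_without_far_arc r dest: wellformed')
  moreover have "(w, x) \<in> ?R" using w(1) \<open>v \<noteq> w\<close> \<open>w \<noteq> x\<close> by auto
  ultimately have "(v, x) \<in> ?R\<^sup>*"
    by (meson sym_reachable rtrancl_trans rtrancl_into_rtrancl)
  then show False using bridge[OF v(1)] by blast
qed

text \<open>If \<open>a\<close> is no farther from \<open>r\<close> than \<open>b\<close>, then
  \<open>a\<close> must coincide with the parent of \<open>b\<close>, so equal distances cannot
  occur.\<close>

lemma adj_cases:
  assumes "r \<in> pverts G" and "(a, b) \<in> parcs G"
  obtains "graph_dist G r b = graph_dist G r a + 1" | "graph_dist G r a = graph_dist G r b + 1"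
proof (cases "graph_dist G r a \<le> graph_dist G r b")
  case True
  have b: "b \<in> pverts G" using assms(2) by (auto dest: wellformed')
  have "r \<noteq> b"
    using True assms graph_dist_eq_0_iff[of r a] no_loops'[OF assms(2)] b
    by (auto dest: wellformed')
  then obtain p where "(p, b) \<in> parcs G" "graph_dist G r b = graph_dist G r p + 1"
    using parent_exists[OF assms(1) b] by metis
  then show thesis using parent_unique[OF assms(1,2) True, of p] that by simp
next
  case False
  then show thesis
    using graph_dist_adj_le[OF assms(1), of b a] arcs_symmetric[OF assms(2)] that by simp
qed

text \<open>A branch can be left only through the root, which confines walks avoiding
  \<open>r\<close> to the branch.\<close>

lemma branch_adj:
  assumes r: "r \<in> pverts G" and rc: "(r, c) \<in> parcs G"
    and a: "a \<in> branch G r c" and ab: "(a, b) \<in> parcs G" and "b \<noteq> r"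
  shows "b \<in> branch G r c"
proof -
  have V: "a \<in> pverts G" "b \<in> pverts G" "c \<in> pverts G" using ab rc by (auto dest: wellformed')
  have lt: "graph_dist G c a < graph_dist G r a" using a by (simp add: branch_def)
  from r ab show ?thesis
  proof (cases rule: adj_cases)
    case 1
    then show ?thesis using lt graph_dist_adj_le[OF V(3) ab] V by (simp add: branch_def)
  next
    case 2
    \<comment> \<open>Since \<open>b\<close> is not the root, \<open>a\<close> has distance at least
      2 from \<open>r\<close>, hence differs from \<open>c\<close> and has a parent
      \<open>a'\<close> with respect to \<open>c\<close>.\<close>
    have "graph_dist G r c \<le> 1" using graph_dist_adj_le[OF r rc] r by simp
    moreover have "graph_dist G r b \<noteq> 0" using graph_dist_eq_0_iff r V \<open>b \<noteq> r\<close> by auto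
    ultimately have "c \<noteq> a" using 2 by auto
    then obtain a' where a': "(a', a) \<in> parcs G" "graph_dist G c a = graph_dist G c a' + 1"
      using parent_exists[OF V(3,1)] by metis
    \<comment> \<open>This is the triangle inequality through the edge from \<open>r\<close> to
      \<open>c\<close>. It makes \<open>a'\<close> no farther from \<open>r\<close> than
      \<open>a\<close>, so the parents of \<open>a\<close> with respect to \<open>c\<close> and
      \<open>r\<close> agree.\<close>
    have dist_le: "graph_dist G r w \<le> graph_dist G c w + 1" if "w \<in> pverts G" for w
      using that
    proof (induction "graph_dist G c w" arbitrary: w rule: less_induct)
      case less
      show ?case
      proof (cases "w = c")
        case True
        then show ?thesis using \<open>graph_dist G r c \<le> 1\<close> by simp
      next
        case False
        then obtain p where p: "(p, w) \<in> parcs G" "graph_dist G c w = graph_dist G c p + 1"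
          using parent_exists[OF V(3) less(2)] by metis
        have "graph_dist G r w \<le> graph_dist G r p + 1" by (rule graph_dist_adj_le[OF r p(1)])
        moreover have "graph_dist G r p \<le> graph_dist G c p + 1"
          using less(1)[of p] p by (auto dest: wellformed')
        ultimately show ?thesis using p(2) by linarith
      qed
    qed
    have "a' \<in> pverts G" using a'(1) by (auto dest: wellformed')
    then have "graph_dist G r a' \<le> graph_dist G r a" using dist_le[of a'] a'(2) lt by simp
    then have "a' = b"
      using parent_unique[OF r a'(1) _ arcs_symmetric[OF ab]] 2 by simp
    then show ?thesis using 2 lt a'(2) V by (simp add: branch_def)
  qed
qed

end

section \<open>Induction over a generated monoid\<close>

lemma (in monoid) generates_monoid_induct [consumes 2, case_names one mult]:
  assumes "generates_monoid G C" and "x \<in> carrier G"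
    and "P \<one>"
    and step: "\<And>y c. \<lbrakk>y \<in> carrier G; P y; c \<in> C\<rbrakk> \<Longrightarrow> P (y \<otimes> c)"
  shows "P x"
proof -
  \<comment> \<open>The elements whose right multiplication preserves \<open>P\<close> form a
    submonoid containing \<open>C\<close>, hence everything; applying this to
    \<open>s = \<one>\<close> gives the claim.\<close>
  let ?H = "{w \<in> carrier G. \<forall>s \<in> carrier G. P s \<longrightarrow> P (s \<otimes> w)}"
  have "submonoid ?H G" by (rule submonoid.intro) (auto simp: m_assoc[symmetric])
  moreover have "C \<subseteq> ?H" using assms(1) step by (auto simp: generates_monoid_def)
  ultimately have "(\<lambda>H. submonoid H G) hull C \<subseteq> ?H" by (intro hull_minimal)
  then have "x \<in> ?H" using assms(1,2) by (auto simp: generates_monoid_def)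
  then show ?thesis using assms(2,3) by force
qed

section \<open>Trees arising as Cayley graphs of finite monoids\<close>

locale cayley_tree = monoid M for M :: "('a, 'b) monoid_scheme" (structure) +
  fixes C :: "'a set"
  assumes finite_carrier: "finite (carrier M)"
    and one_notin: "\<one> \<notin> C"
    and generates: "generates_monoid M C"
    and undirected_tree: "undirected_tree (cayley_graph M C)"
begin

abbreviation "T \<equiv> cayley_graph M C"

abbreviation "dist1 \<equiv> graph_dist T \<one>"

definition "children x = {y \<in> carrier M. (x, y) \<in> parcs T \<and> dist1 y = dist1 x + 1}"

sublocale tree: undirected_tree_graph T
  using undirected_tree
  by (auto simp: undirected_tree_def undirected_tree_graph_def undirected_tree_graph_axioms_def)

lemma pverts_T [simp]: "pverts T = carrier M"
  by (simp add: cayley_graph_def)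

lemma outer_degree_eq: "outer_degree T \<one> x = card (children x)"
  by (simp add: outer_degree_def children_def)

lemma finite_children [simp]: "finite (children x)"
  using finite_carrier by (simp add: children_def)

lemma gen_closed [simp]: "c \<in> C \<Longrightarrow> c \<in> carrier M"
  using generates by (auto simp: generates_monoid_def)

lemma arc_mult:
  "\<lbrakk>x \<in> carrier M; c \<in> C; x \<otimes> c \<noteq> x\<rbrakk> \<Longrightarrow> (x, x \<otimes> c) \<in> parcs T"
  by (auto simp: cayley_graph_def)

lemma dist1_mult_gen_le:
  assumes "x \<in> carrier M" and "c \<in> C"
  shows "dist1 (x \<otimes> c) \<le> dist1 x + 1"
  using tree.graph_dist_adj_le[of \<one> x "x \<otimes> c"] arc_mult[OF assms] assms(1)
  by (cases "x \<otimes> c = x") auto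

lemma dist1_one [simp]: "dist1 \<one> = 0" by simp

lemma dist1_gen:
  assumes "c \<in> C" shows "dist1 c = 1"
  using dist1_mult_gen_le[of \<one> c] tree.graph_dist_eq_0_iff[of \<one> c] assms one_notin by force

text \<open>
  If \<open>z\<close> were not of the form \<open>y \<otimes> c\<close>, then the component of \<open>\<one>\<close> in the tree without the
  edge \<open>{y, z}\<close> would be closed under right multiplication by generators, although it misses \<open>z\<close>.
\<close>
lemma child_eq_mult:
  assumes "y \<in> carrier M" and "z \<in> children y"
  shows "\<exists>c\<in>C. z = y \<otimes> c"
proof (rule ccontr)
  assume neg: "\<not> (\<exists>c\<in>C. z = y \<otimes> c)"
  let ?R = "parcs T - {(y, z), (z, y)}"
  have z: "z \<in> carrier M" "(y, z) \<in> parcs T" "dist1 z = dist1 y + 1"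
    using assms(2) by (auto simp: children_def)
  have y_reach: "(\<one>, y) \<in> ?R\<^sup>*"
    using assms(1) z by (intro tree.reachable_without_far_arc) auto
  then have z_not_reach: "(\<one>, z) \<notin> ?R\<^sup>*"
    using tree.bridge[OF z(2)] by (meson tree.sym_reachable rtrancl_trans)
  have "(\<one>, x) \<in> ?R\<^sup>*" if "x \<in> carrier M" for x
    using generates that
  proof (induction rule: generates_monoid_induct)
    case (mult x c)
    have "x \<noteq> z" using mult z_not_reach by auto
    moreover have "x \<noteq> y \<or> x \<otimes> c \<noteq> z" using neg mult by blast
    ultimately have "x \<otimes> c \<noteq> x \<Longrightarrow> (x, x \<otimes> c) \<in> ?R" using arc_mult mult by auto
    then show ?case using mult by (metis rtrancl_into_rtrancl)
  qed simp
  with z_not_reach z(1) show False by blast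
qed

lemma parent_gen:
  assumes "x \<in> carrier M" and "x \<noteq> \<one>"
  obtains p c where "p \<in> carrier M" and "c \<in> C" and "x = p \<otimes> c" and "x \<in> children p"
proof -
  obtain p where p: "(p, x) \<in> parcs T" "dist1 x = dist1 p + 1"
    using tree.parent_exists[of \<one> x] assms by auto
  then have "p \<in> carrier M" "x \<in> children p"
    using assms(1) tree.wellformed'(1)[OF p(1)] by (auto simp: children_def)
  then show thesis using child_eq_mult that by metis
qed

text \<open>Going up a geodesic from \<open>\<one>\<close>, each step is a right multiplication by a
  generator. Unlike in \<open>generates_monoid_induct\<close>, each step may be assumed to increase
  the distance.\<close>

lemma dist1_induct [consumes 1, case_names one child]:
  assumes "x \<in> carrier M"
    and "P \<one>"
    and "\<And>y c. \<lbrakk>y \<in> carrier M; c \<in> C; y \<otimes> c \<in> children y; P y\<rbrakk> \<Longrightarrow> P (y \<otimes> c)"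
  shows "P x"
  using assms(1)
proof (induction "dist1 x" arbitrary: x rule: less_induct)
  case less
  show ?case
  proof (cases "x = \<one>")
    case False
    with less obtain p c where "p \<in> carrier M" "c \<in> C" "x = p \<otimes> c" "x \<in> children p"
      using parent_gen by metis
    then show ?thesis using less(1)[of p] assms(3)[of p c] by (auto simp: children_def)
  qed (use assms(2) in simp)
qed

text \<open>Left multiplication by \<open>c\<close> commutes with right multiplications, so it maps
  a geodesic from \<open>\<one>\<close> to \<open>x\<close> to a walk from \<open>c\<close>,
  possibly with stalls.\<close>

lemma dist1_gen_mult_le:
  assumes "x \<in> carrier M" and "c \<in> C"
  shows "dist1 (c \<otimes> x) \<le> dist1 x + 1"
  using assms(1)
proof (induction rule: dist1_induct)
  case one
  then show ?case using assms(2) dist1_gen by simp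
next
  case (child y d)
  then show ?case
    using dist1_mult_gen_le[of "c \<otimes> y" d] assms(2)
    by (auto simp: m_assoc children_def)
qed

lemma first_letter:
  assumes "x \<in> carrier M" and "x \<noteq> \<one>"
  shows "\<exists>c\<in>C. \<exists>y\<in>carrier M. x = c \<otimes> y \<and> dist1 x = dist1 y + 1"
  using assms
proof (induction rule: dist1_induct)
  case one
  then show ?case by simp
next
  case (child p d)
  have dx: "dist1 (p \<otimes> d) = dist1 p + 1" using child by (simp add: children_def)
  show ?case
  proof (cases "p = \<one>")
    case True
    then show ?thesis using child dx by (intro bexI[of _ d] bexI[of _ \<one>]) auto
  next
    case False
    then obtain c y where c: "c \<in> C" "y \<in> carrier M" "p = c \<otimes> y" "dist1 p = dist1 y + 1"
      using child by blast
    have eq: "p \<otimes> d = c \<otimes> (y \<otimes> d)" using c child by (simp add: m_assoc)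
    \<comment> \<open>Appending \<open>d\<close> and prepending \<open>c\<close> each add at most
      one, while together they add two to the distance of \<open>y\<close>; so each adds exactly
      one.\<close>
    have "dist1 (y \<otimes> d) \<le> dist1 y + 1" using dist1_mult_gen_le c child by blast
    moreover have "dist1 (p \<otimes> d) \<le> dist1 (y \<otimes> d) + 1"
      using dist1_gen_mult_le c child eq by simp
    ultimately have "dist1 (p \<otimes> d) = dist1 (y \<otimes> d) + 1" using dx c(4) by simp
    with eq c child show ?thesis by (intro bexI[of _ c] bexI[of _ "y \<otimes> d"]) auto
  qed
qed

lemma ex_outer_degree_ge_below:
  assumes "x \<in> carrier M" and "x \<noteq> \<one>"
  shows "\<exists>y\<in>carrier M. dist1 x = dist1 y + 1 \<and> outer_degree T \<one> x \<le> outer_degree T \<one> y"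
proof -
  obtain c y where c: "c \<in> C" "y \<in> carrier M" "x = c \<otimes> y" "dist1 x = dist1 y + 1"
    using first_letter assms by blast
  have "children x \<subseteq> (\<lambda>w. c \<otimes> w) ` children y"
  proof
    fix z assume z: "z \<in> children x"
    then obtain d where d: "d \<in> C" "z = x \<otimes> d" using child_eq_mult assms by metis
    have eq: "z = c \<otimes> (y \<otimes> d)" using d c by (simp add: m_assoc)
    \<comment> \<open>The factor \<open>c\<close> accounts for at most one of these two levels, so
      \<open>y \<otimes> d\<close> must lie one level above \<open>y\<close>.\<close>
    have "dist1 z = dist1 y + 2" using z c by (simp add: children_def)
    moreover have "dist1 z \<le> dist1 (y \<otimes> d) + 1" using dist1_gen_mult_le eq c d by simp
    moreover have "dist1 (y \<otimes> d) \<le> dist1 y + 1" using dist1_mult_gen_le c d by simp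
    ultimately have "dist1 (y \<otimes> d) = dist1 y + 1" by simp
    then have "y \<otimes> d \<in> children y" using arc_mult[of y d] c d
      by (cases "y \<otimes> d = y") (auto simp: children_def)
    then show "z \<in> (\<lambda>w. c \<otimes> w) ` children y" using eq by blast
  qed
  then have "card (children x) \<le> card (children y)" by (rule surj_card_le[OF finite_children])
  then show ?thesis using c by (auto simp: outer_degree_eq)
qed

section \<open>Left translations, branches and the second claim\<close>

text \<open>A right inverse makes the translation surjective, finiteness then makes it injective,
  and left cancellation carries the right-multiplication adjacency both ways.\<close>

lemma left_mult_in_graph_Aut:
  assumes "c \<in> C" and "y \<in> carrier M" and "c \<otimes> y = \<one>"
  shows "left_mult M c \<in> graph_Aut T"
proof -
  have c: "c \<in> carrier M" using assms(1) by simp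
  have "(\<lambda>x. c \<otimes> x) ` carrier M = carrier M"
  proof
    show "carrier M \<subseteq> (\<lambda>x. c \<otimes> x) ` carrier M"
    proof
      fix x assume "x \<in> carrier M"
      then have "x = c \<otimes> (y \<otimes> x)" "y \<otimes> x \<in> carrier M"
        using assms c by (simp_all add: m_assoc[symmetric])
      then show "x \<in> (\<lambda>x. c \<otimes> x) ` carrier M" by blast
    qed
  qed (use c in auto)
  then have bij: "bij_betw (\<lambda>x. c \<otimes> x) (carrier M) (carrier M)"
    using finite_carrier by (simp add: bij_betw_def eq_card_imp_inj_on)
  have inj: "c \<otimes> a = c \<otimes> b \<longleftrightarrow> a = b" if "a \<in> carrier M" "b \<in> carrier M" for a b
    using bij that by (auto simp: bij_betw_def inj_on_def)
  have "(c \<otimes> a, c \<otimes> b) \<in> parcs T \<longleftrightarrow> (a, b) \<in> parcs T"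
    if "a \<in> carrier M" "b \<in> carrier M" for a b
    using that c by (auto simp: cayley_graph_def m_assoc inj)
  moreover have "bij_betw (left_mult M c) (carrier M) (carrier M)"
    using bij by (subst bij_betw_cong[of _ _ "\<lambda>x. c \<otimes> x"]) (auto simp: left_mult_def)
  ultimately show ?thesis
    by (auto simp: graph_Aut_def Bij_def left_mult_def)
qed

text \<open>Such a child is \<open>c \<otimes> (x \<otimes> d)\<close>, where
  \<open>x \<otimes> d\<close> is a neighbour of \<open>x\<close> but not a child, hence its parent.
  As parents are unique, there is at most one exceptional child.\<close>

lemma child_gen_mult_not_image:
  assumes x: "x \<in> carrier M" and c: "c \<in> C" and z: "z \<in> children (c \<otimes> x)"
    and not_img: "z \<notin> (\<lambda>w. c \<otimes> w) ` children x"
  shows "\<exists>u. (u, x) \<in> parcs T \<and> dist1 x = dist1 u + 1 \<and> z = c \<otimes> u"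
proof -
  obtain d where d: "d \<in> C" "z = c \<otimes> x \<otimes> d"
    using child_eq_mult z x c by (metis gen_closed m_closed)
  have eq: "z = c \<otimes> (x \<otimes> d)" using d x c by (simp add: m_assoc)
  have "x \<otimes> d \<noteq> x" using z eq by (auto simp: children_def)
  then have arc: "(x, x \<otimes> d) \<in> parcs T" using arc_mult x d by blast
  have "x \<otimes> d \<notin> children x" using not_img eq by blast
  then have "dist1 (x \<otimes> d) \<noteq> dist1 x + 1" using arc x d by (auto simp: children_def)
  then have "dist1 x = dist1 (x \<otimes> d) + 1"
    using tree.adj_cases[of \<one> x "x \<otimes> d"] arc by auto
  then show ?thesis using eq tree.arcs_symmetric[OF arc] by blast
qed

lemma gen_mult_in_branch:
  assumes "x \<in> carrier M" and c: "c \<in> C"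
    and no_inv: "\<And>y. y \<in> carrier M \<Longrightarrow> c \<otimes> y \<noteq> \<one>"
  shows "c \<otimes> x \<in> branch T \<one> c"
  using assms(1)
proof (induction rule: dist1_induct)
  case one
  then show ?case using c dist1_gen by (simp add: branch_def)
next
  case (child y d)
  have "(\<one>, c) \<in> parcs T" using arc_mult[of \<one> c] c one_notin by auto
  moreover have "c \<otimes> y \<otimes> d \<noteq> c \<otimes> y \<Longrightarrow> (c \<otimes> y, c \<otimes> y \<otimes> d) \<in> parcs T"
    using arc_mult c child by simp
  ultimately have "c \<otimes> y \<otimes> d \<in> branch T \<one> c"
    using tree.branch_adj[of \<one> c "c \<otimes> y" "c \<otimes> y \<otimes> d"] child c no_inv[of "y \<otimes> d"]
    by (cases "c \<otimes> y \<otimes> d = c \<otimes> y") (auto simp: m_assoc)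
  then show ?case using c child by (simp add: m_assoc)
qed

lemma outer_degree_gen_mult_le:
  assumes x: "x \<in> carrier M" and c: "c \<in> C"
    and no_inv: "\<And>y. y \<in> carrier M \<Longrightarrow> c \<otimes> y \<noteq> \<one>"
  shows "outer_degree T \<one> (c \<otimes> x) \<le> outer_degree T \<one> x + (if x \<in> C \<union> {\<one>} then 0 else 1)"
proof (cases "x \<in> C \<union> {\<one>}")
  case True
  have "children (c \<otimes> x) \<subseteq> (\<lambda>w. c \<otimes> w) ` children x"
  proof (rule subsetI, rule ccontr)
    fix z assume z: "z \<in> children (c \<otimes> x)" "z \<notin> (\<lambda>w. c \<otimes> w) ` children x"
    then obtain u where u: "(u, x) \<in> parcs T" "dist1 x = dist1 u + 1" "z = c \<otimes> u"
      using child_gen_mult_not_image x c by blast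
    \<comment> \<open>Here \<open>x\<close> has distance at most 1, so its parent is
      \<open>\<one>\<close> and the exceptional child would be \<open>c\<close> itself, at distance
      1. This would force \<open>c \<otimes> x = \<one>\<close>, so no extra term arises.\<close>
    then have "u \<in> carrier M" "dist1 u = 0"
      using True dist1_gen tree.wellformed'(1)[OF u(1)] by auto
    then have "u = \<one>" using tree.graph_dist_eq_0_iff[of \<one> u] by simp
    then have "dist1 (c \<otimes> x) = 0" using z(1) u(3) c dist1_gen by (simp add: children_def)
    then have "c \<otimes> x = \<one>" using tree.graph_dist_eq_0_iff[of \<one> "c \<otimes> x"] c x by simp
    then show False using no_inv x by blast
  qed
  then have "card (children (c \<otimes> x)) \<le> card (children x)"
    by (rule surj_card_le[OF finite_children])
  then show ?thesis using True by (simp add: outer_degree_eq)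
next
  case False
  then obtain p where p: "(p, x) \<in> parcs T" "dist1 x = dist1 p + 1"
    using tree.parent_exists[of \<one> x] x by auto
  have "children (c \<otimes> x) \<subseteq> insert (c \<otimes> p) ((\<lambda>w. c \<otimes> w) ` children x)"
  proof
    fix z assume z: "z \<in> children (c \<otimes> x)"
    show "z \<in> insert (c \<otimes> p) ((\<lambda>w. c \<otimes> w) ` children x)"
    proof (cases "z \<in> (\<lambda>w. c \<otimes> w) ` children x")
      case notin: False
      then obtain u where u: "(u, x) \<in> parcs T" "dist1 x = dist1 u + 1" "z = c \<otimes> u"
        using child_gen_mult_not_image x c z by blast
      have "dist1 u \<le> dist1 x" "dist1 p \<le> dist1 x" using u(2) p(2) by linarith+
      then have "u = p" using tree.parent_unique[OF _ u(1) _ p(1), of \<one>] by simp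
      then show ?thesis using u by simp
    qed simp
  qed
  then have "card (children (c \<otimes> x)) \<le> card (insert (c \<otimes> p) ((\<lambda>w. c \<otimes> w) ` children x))"
    by (intro card_mono) auto
  also have "\<dots> \<le> card (children x) + 1"
    using card_image_le[OF finite_children, of "\<lambda>w. c \<otimes> w" x]
    by (auto simp: card_insert_if)
  finally show ?thesis using False by (simp add: outer_degree_eq)
qed

end

theorem proposition5p2:
  fixes M :: "('a, 'b) monoid_scheme"
    and C :: "'a set"
    and T :: "'a pair_pre_digraph"
  assumes "monoid M"
    and "finite (carrier M)"
    and "C \<subseteq> carrier M"
    and "\<one>\<^bsub>M\<^esub> \<notin> C"
    and "generates_monoid M C"
    and "T = cayley_graph M C"
    and "undirected_tree T"
  shows "(\<forall>x \<in> pverts T - {\<one>\<^bsub>M\<^esub>}. \<exists>y \<in> pverts T.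
            graph_dist T \<one>\<^bsub>M\<^esub> x = graph_dist T \<one>\<^bsub>M\<^esub> y + 1 \<and>
            outer_degree T \<one>\<^bsub>M\<^esub> x \<le> outer_degree T \<one>\<^bsub>M\<^esub> y)
       \<and> (graph_Aut T \<inter> {left_mult M x | x. x \<in> carrier M} = {\<lambda>x\<in>pverts T. x} \<longrightarrow>
          (\<forall>x \<in> pverts T. \<forall>c \<in> C. \<exists>y \<in> branch T \<one>\<^bsub>M\<^esub> c.
            graph_dist T \<one>\<^bsub>M\<^esub> y \<le> graph_dist T \<one>\<^bsub>M\<^esub> x + 1 \<and>
            outer_degree T \<one>\<^bsub>M\<^esub> y \<le> outer_degree T \<one>\<^bsub>M\<^esub> x
              + (if x \<in> C \<union> {\<one>\<^bsub>M\<^esub>} then 0 else 1)))"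
proof -
  interpret cayley_tree M C
    using assms by (auto simp: cayley_tree_def cayley_tree_axioms_def)
  have no_inv: "c \<otimes>\<^bsub>M\<^esub> y \<noteq> \<one>\<^bsub>M\<^esub>"
    if triv: "graph_Aut T \<inter> {left_mult M x | x. x \<in> carrier M} = {\<lambda>x\<in>carrier M. x}"
      and c: "c \<in> C" and y: "y \<in> carrier M" for c y
  proof
    assume "c \<otimes>\<^bsub>M\<^esub> y = \<one>\<^bsub>M\<^esub>"
    then have "left_mult M c \<in> graph_Aut T \<inter> {left_mult M x | x. x \<in> carrier M}"
      using left_mult_in_graph_Aut c y assms(6) by auto
    then have "left_mult M c = (\<lambda>x\<in>carrier M. x)" using triv by blast
    \<comment> \<open>The identity fixes the neutral element, whereas left multiplication by
      \<open>c\<close> sends it to \<open>c\<close>.\<close>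
    then have "left_mult M c \<one>\<^bsub>M\<^esub> = \<one>\<^bsub>M\<^esub>" by simp
    then have "c = \<one>\<^bsub>M\<^esub>" using c by (simp add: left_mult_def)
    then show False using c one_notin by blast
  qed
  have "\<exists>y \<in> branch T \<one>\<^bsub>M\<^esub> c.
          graph_dist T \<one>\<^bsub>M\<^esub> y \<le> graph_dist T \<one>\<^bsub>M\<^esub> x + 1 \<and>
          outer_degree T \<one>\<^bsub>M\<^esub> y \<le> outer_degree T \<one>\<^bsub>M\<^esub> x
            + (if x \<in> C \<union> {\<one>\<^bsub>M\<^esub>} then 0 else 1)"
    if triv: "graph_Aut T \<inter> {left_mult M x | x. x \<in> carrier M} = {\<lambda>x\<in>carrier M. x}"
      and x: "x \<in> carrier M" and c: "c \<in> C" for x c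
    using gen_mult_in_branch[OF x c no_inv[OF triv c]] dist1_gen_mult_le[OF x c]
      outer_degree_gen_mult_le[OF x c no_inv[OF triv c]]
    unfolding assms(6) by blast
  then show ?thesis
    using ex_outer_degree_ge_below unfolding assms(6) pverts_T by blast
qed

end
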